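(* Let $S$ be a factorizable inverse epigroup with an identity element and with group of units $G$. Let $a,b\in S$. Then $a\sim b$ if and only if $ae_a\sim_G be_b$.
   Context: An epigroup is a semigroup in which every element $a$ is group-bound, i.e. some power $a^t$, $t\ge 1$, belongs to a subgroup of the semigroup (a subsemigroup which is a group under the same operation). For a group-bound element $a$, $e_a$ denotes the identity element of the group $H_{a^t}$ (the $\mathcal{H}$-class of $a^t$ for Green's relation $\mathcal{H}$), where $t\ge 1$ is such that $H_{a^t}$ is a group; this does not depend on the choice of $t$. An inverse monoid $S$ with group of units $G$ is factorizable if for each $s\in S$ there is $g\in G$ such that $s\leq g$ in the natural partial order, i.e. $ss^{-1}=sg^{-1}$. For $a,b\in S$ write $a\sim_G b$ ($G$-conjugacy) if $a=g^{-1}bg$ for some $g\in G$. Write $a\sim_p b$ if there exist $x,y\in S$ with $a=xy$ and $b=yx$; the relation $\sim$ (conjugacy) is the transitive closure of $\sim_p$ on $S$. *)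

theory Defs
  imports "HOL-Algebra.Group"
begin

(* The identity e of a subgroup H of S need not be the identity of S. *)
definition semigroup_subgroup :: "'a set \<Rightarrow> ('a, 'b) monoid_scheme \<Rightarrow> bool" where
  "semigroup_subgroup H S \<longleftrightarrow>
     H \<subseteq> carrier S \<and> (\<exists>e. group (S\<lparr>carrier := H, one := e\<rparr>))"

definition group_bound :: "('a, 'b) monoid_scheme \<Rightarrow> 'a \<Rightarrow> bool" where
  "group_bound S a \<longleftrightarrow>
     (\<exists>t::nat. t \<ge> 1 \<and> (\<exists>H. semigroup_subgroup H S \<and> a [^]\<^bsub>S\<^esub> t \<in> H))"

locale inverse_monoid = monoid S for S (structure) +
  assumes unique_inverse:
    "s \<in> carrier S \<Longrightarrow> \<exists>!t. t \<in> carrier S \<and> s \<otimes> t \<otimes> s = s \<and> t \<otimes> s \<otimes> t = t"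

locale epigroup_monoid = monoid S for S (structure) +
  assumes all_group_bound: "a \<in> carrier S \<Longrightarrow> group_bound S a"

(* The semigroup inverse, as opposed to the two-sided inverse m_inv of a unit. *)
definition sinv :: "('a, 'b) monoid_scheme \<Rightarrow> 'a \<Rightarrow> 'a" where
  "sinv S s = (THE t. t \<in> carrier S \<and>
     s \<otimes>\<^bsub>S\<^esub> t \<otimes>\<^bsub>S\<^esub> s = s \<and> t \<otimes>\<^bsub>S\<^esub> s \<otimes>\<^bsub>S\<^esub> t = t)"

definition natural_le :: "('a, 'b) monoid_scheme \<Rightarrow> 'a \<Rightarrow> 'a \<Rightarrow> bool" where
  "natural_le S s t \<longleftrightarrow> s \<otimes>\<^bsub>S\<^esub> sinv S s = s \<otimes>\<^bsub>S\<^esub> sinv S t"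

locale factorizable_inverse_monoid = inverse_monoid +
  assumes factorizable: "s \<in> carrier S \<Longrightarrow> \<exists>g\<in>Units S. natural_le S s g"

(* Principal one-sided ideals are taken in a monoid, where S^1 = S. *)
definition green_L :: "('a, 'b) monoid_scheme \<Rightarrow> 'a \<Rightarrow> 'a \<Rightarrow> bool" where
  "green_L S a b \<longleftrightarrow>
     {x \<otimes>\<^bsub>S\<^esub> a | x. x \<in> carrier S} = {x \<otimes>\<^bsub>S\<^esub> b | x. x \<in> carrier S}"

definition green_R :: "('a, 'b) monoid_scheme \<Rightarrow> 'a \<Rightarrow> 'a \<Rightarrow> bool" where
  "green_R S a b \<longleftrightarrow>
     {a \<otimes>\<^bsub>S\<^esub> x | x. x \<in> carrier S} = {b \<otimes>\<^bsub>S\<^esub> x | x. x \<in> carrier S}"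

definition H_class :: "('a, 'b) monoid_scheme \<Rightarrow> 'a \<Rightarrow> 'a set" where
  "H_class S a = {b \<in> carrier S. green_L S a b \<and> green_R S a b}"

(* Meaningful for group-bound a, where e does not depend on the choice of t. *)
definition idem_of :: "('a, 'b) monoid_scheme \<Rightarrow> 'a \<Rightarrow> 'a" where
  "idem_of S a = (THE e. \<exists>t::nat. t \<ge> 1 \<and>
     group (S\<lparr>carrier := H_class S (a [^]\<^bsub>S\<^esub> t), one := e\<rparr>))"

definition G_conj :: "('a, 'b) monoid_scheme \<Rightarrow> ('a \<times> 'a) set" where
  "G_conj S = {(a, b). a \<in> carrier S \<and> b \<in> carrier S \<and>
     (\<exists>g\<in>Units S. a = inv\<^bsub>S\<^esub> g \<otimes>\<^bsub>S\<^esub> b \<otimes>\<^bsub>S\<^esub> g)}"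

definition p_conj :: "('a, 'b) monoid_scheme \<Rightarrow> ('a \<times> 'a) set" where
  "p_conj S = {(a, b). a \<in> carrier S \<and> b \<in> carrier S \<and>
     (\<exists>x\<in>carrier S. \<exists>y\<in>carrier S. a = x \<otimes>\<^bsub>S\<^esub> y \<and> b = y \<otimes>\<^bsub>S\<^esub> x)}"

definition sg_conj :: "('a, 'b) monoid_scheme \<Rightarrow> ('a \<times> 'a) set" where
  "sg_conj S = (p_conj S)\<^sup>+"

end

theory Submission
  imports Defs
begin

text \<open>
  For an element \<open>a\<close> with idempotent \<open>e\<close>, the product \<open>a \<otimes> e\<close> is the part of \<open>a\<close> that lies in a
  group: thinking of \<open>a\<close> as a partial injective map, \<open>e\<close> is the stable domain, on which some power
  of \<open>a\<close> is a permutation, and \<open>a \<otimes> e\<close> is the restriction of \<open>a\<close> to it.  The theorem holds because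
  semigroup conjugacy sees exactly this part, up to units.

  In any inverse monoid, a group-bound \<open>a\<close> is conjugate to \<open>a \<otimes> e\<close>
  (\<open>sg_conj_mult_group_identity\<close>).  With
  \<open>p\<close> the semigroup inverse of \<open>a\<close>, the idempotents \<open>F n = p^n \<otimes> a^n\<close> decrease, and one step
  from \<open>F n \<otimes> a\<close> to \<open>F (n + 1) \<otimes> a\<close> is a single swap of two factors.  Once \<open>a^t\<close> lies in a group,
  \<open>F t\<close> and \<open>e\<close> are idempotents that generate the same left ideal as \<open>a^t\<close>, so they coincide.
  Since conjugation by a unit is also a swap of factors, this gives the implication from
  \<open>G\<close>-conjugacy to conjugacy.

  Conversely, a swap \<open>a = x \<otimes> y\<close>, \<open>b = y \<otimes> x\<close> makes \<open>a \<otimes> e\<close> and \<open>b \<otimes> f\<close> conjugate by a unit, where \<open>f\<close>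
  is the idempotent of \<open>b\<close> (\<open>p_conj_imp_G_conj\<close>).  The element \<open>u = e \<otimes> x = x \<otimes> f\<close> is a bijection
  between the two stable domains, and it intertwines \<open>a \<otimes> e\<close> with \<open>b \<otimes> f\<close>.  Factorizability
  extends it to a unit \<open>g\<close>, with \<open>u = e \<otimes> g\<close>, and \<open>g\<close> does the conjugation.  As \<open>G\<close>-conjugacy is
  transitive, chains of swaps are covered as well.
\<close>

section \<open>Group elements and the idempotent of a group-bound element\<close>

context monoid
begin

text \<open>
  Membership of \<open>u\<close> in a subgroup with identity \<open>e\<close>, expressed by equations: \<open>u\<close> and \<open>y\<close> are
  mutually inverse units of the local monoid \<open>eGe\<close>, where \<open>G\<close> is the ambient monoid.  Naming the
  inverse replaces reasoning about \<open>\<H>\<close>-classes by equational reasoning.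
\<close>

definition group_inverse :: "'a \<Rightarrow> 'a \<Rightarrow> 'a \<Rightarrow> bool" where
  "group_inverse u e y \<longleftrightarrow> u \<in> carrier G \<and> e \<in> carrier G \<and> y \<in> carrier G \<and>
     e \<otimes> u = u \<and> u \<otimes> e = u \<and> e \<otimes> y = y \<and> y \<otimes> e = y \<and> u \<otimes> y = e \<and> y \<otimes> u = e"

lemma group_inverse_sym: "group_inverse u e y \<Longrightarrow> group_inverse y e u"
  by (simp add: group_inverse_def)

lemma group_inverse_idem: "group_inverse u e y \<Longrightarrow> e \<otimes> e = e"
  unfolding group_inverse_def by (metis m_assoc)

lemma group_inverse_one: "group_inverse u e y \<Longrightarrow> group_inverse e e e"
  using group_inverse_idem by (auto simp: group_inverse_def)

text \<open>
  As for units of any monoid, a left and a right inverse agree after they have been cut down to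
  \<open>eGe\<close>.  This form fits Green's relations, which supply one-sided inverses outside of \<open>eGe\<close>.
\<close>

lemma group_inverse_of_one_sided:
  assumes carr: "u \<in> carrier G" "e \<in> carrier G" "l \<in> carrier G" "r \<in> carrier G"
    and "e \<otimes> u = u" "u \<otimes> e = u" "l \<otimes> u = e" "u \<otimes> r = e"
  shows "group_inverse u e (e \<otimes> r \<otimes> e)"
proof -
  have ee: "e \<otimes> e = e"
    using assms by (metis m_assoc)
  have "u \<otimes> (e \<otimes> r \<otimes> e) = e"
    using assms ee by (metis m_assoc m_closed)
  moreover have "e \<otimes> l \<otimes> e \<otimes> u = e"
    using assms ee by (metis m_assoc m_closed)
  ultimately have "e \<otimes> r \<otimes> e = e \<otimes> l \<otimes> e"
    using carr ee by (metis m_assoc m_closed)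
  then show ?thesis
    using assms ee \<open>u \<otimes> (e \<otimes> r \<otimes> e) = e\<close> \<open>e \<otimes> l \<otimes> e \<otimes> u = e\<close>
    unfolding group_inverse_def by (metis m_assoc m_closed)
qed

lemma group_inverse_mult:
  assumes "group_inverse u e y" "group_inverse v e z"
  shows "group_inverse (u \<otimes> v) e (z \<otimes> y)"
proof -
  have carr: "u \<in> carrier G" "e \<in> carrier G" "y \<in> carrier G" "v \<in> carrier G" "z \<in> carrier G"
    using assms by (auto simp: group_inverse_def)
  have "u \<otimes> v \<otimes> (z \<otimes> y) = u \<otimes> (v \<otimes> z) \<otimes> y"
    using carr by (simp add: m_assoc)
  also have "\<dots> = e"
    using assms by (simp add: group_inverse_def)
  finally have 1: "u \<otimes> v \<otimes> (z \<otimes> y) = e" .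
  have "z \<otimes> y \<otimes> (u \<otimes> v) = z \<otimes> (y \<otimes> u) \<otimes> v"
    using carr by (simp add: m_assoc)
  also have "\<dots> = e"
    using assms by (simp add: group_inverse_def)
  finally have 2: "z \<otimes> y \<otimes> (u \<otimes> v) = e" .
  show ?thesis
    using assms 1 2 carr unfolding group_inverse_def by (metis m_assoc m_closed)
qed

lemma group_inverse_pow_Suc:
  assumes "group_inverse u e y"
  shows "\<exists>z. group_inverse (u [^] Suc k) e z"
proof (induction k)
  case 0
  then show ?case
    using assms by (auto simp: group_inverse_def)
next
  case (Suc k)
  then show ?case
    using group_inverse_mult[OF _ assms] nat_pow_Suc[of u "Suc k"] by metis
qed

text \<open>
  Passing to multiples of the exponent brings powers of two elements, or two group powers of one
  element, to a common exponent.
\<close>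

lemma group_inverse_pow_mult:
  assumes "group_inverse (a [^] t) e y" and "a \<in> carrier G" and "k \<ge> (1::nat)"
  shows "\<exists>z. group_inverse (a [^] (t * k)) e z"
  using group_inverse_pow_Suc[OF assms(1), of "k - 1"] assms by (simp add: nat_pow_pow)

lemma group_identity_unique:
  assumes "group_inverse u e y" "group_inverse u f z"
  shows "e = f"
  using assms unfolding group_inverse_def by (metis m_assoc)

lemma group_inverse_of_subgroup:
  assumes "H \<subseteq> carrier G" and "group (G\<lparr>carrier := H, one := e\<rparr>)" and "u \<in> H"
  shows "\<exists>y. group_inverse u e y"
proof -
  interpret H: group "G\<lparr>carrier := H, one := e\<rparr>"
    by fact
  obtain y where "y \<in> H" "y \<otimes> u = e" "u \<otimes> y = e"
    using H.Units_eq assms(3) by (auto simp: Units_def)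
  then show ?thesis
    using H.l_one H.r_one H.one_closed assms(1,3) unfolding group_inverse_def by auto
qed

text \<open>
  The maximal subgroup at \<open>e\<close> is the whole unit group of \<open>eGe\<close>.  An element \<open>\<H>\<close>-equivalent to \<open>u\<close>
  divides \<open>u\<close> and hence \<open>e\<close> on both sides; conversely, all units of \<open>eGe\<close> generate the same
  one-sided ideals as \<open>e\<close>.
\<close>

lemma H_class_eq_unit_group:
  assumes u: "group_inverse u e z"
  shows "H_class G u = {b. \<exists>y. group_inverse b e y}"
proof (intro equalityI subsetI CollectI)
  fix b assume "b \<in> H_class G u"
  then have b: "b \<in> carrier G" and L: "green_L G u b" and R: "green_R G u b"
    by (auto simp: H_class_def)
  have c: "u \<in> carrier G" "e \<in> carrier G" "z \<in> carrier G"
    and eq: "e \<otimes> u = u" "u \<otimes> e = u" "u \<otimes> z = e" "z \<otimes> u = e"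
    using u by (auto simp: group_inverse_def)
  have "b \<in> {x \<otimes> u | x. x \<in> carrier G}" "b \<in> {u \<otimes> x | x. x \<in> carrier G}"
    using L R b unfolding green_L_def green_R_def by (force intro: l_one[symmetric] r_one[symmetric])+
  moreover have "u \<in> {x \<otimes> b | x. x \<in> carrier G}" "u \<in> {b \<otimes> x | x. x \<in> carrier G}"
    using L R c unfolding green_L_def green_R_def by (force intro: l_one[symmetric] r_one[symmetric])+
  ultimately obtain p q r s where
    "p \<in> carrier G" "b = p \<otimes> u" "q \<in> carrier G" "b = u \<otimes> q"
    "r \<in> carrier G" "u = r \<otimes> b" "s \<in> carrier G" "u = b \<otimes> s"
    by blast
  then have "e \<otimes> b = b" "b \<otimes> e = b" "(z \<otimes> r) \<otimes> b = e" "b \<otimes> (s \<otimes> z) = e"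
    using c eq b by (metis m_assoc)+
  then show "\<exists>y. group_inverse b e y"
    using group_inverse_of_one_sided b c \<open>r \<in> carrier G\<close> \<open>s \<in> carrier G\<close> by (metis m_closed)
next
  fix b assume "b \<in> {b. \<exists>y. group_inverse b e y}"
  then obtain y where y: "group_inverse b e y"
    by blast
  have one_sided: "{x \<otimes> v | x. x \<in> carrier G} \<subseteq> {x \<otimes> w | x. x \<in> carrier G}"
    "{v \<otimes> x | x. x \<in> carrier G} \<subseteq> {w \<otimes> x | x. x \<in> carrier G}"
    if "group_inverse v e v'" "group_inverse w e w'" for v w v' w'
  proof -
    have c: "v \<in> carrier G" "w \<in> carrier G" "w' \<in> carrier G" "e \<in> carrier G"
      and "v \<otimes> e = v" "e \<otimes> v = v" "w \<otimes> w' = e" "w' \<otimes> w = e"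
      using that by (auto simp: group_inverse_def)
    then have "x \<otimes> v = (x \<otimes> v \<otimes> w') \<otimes> w" "v \<otimes> x = w \<otimes> (w' \<otimes> v \<otimes> x)"
      if "x \<in> carrier G" for x
      using that by (metis m_assoc m_closed)+
    then show "{x \<otimes> v | x. x \<in> carrier G} \<subseteq> {x \<otimes> w | x. x \<in> carrier G}"
      "{v \<otimes> x | x. x \<in> carrier G} \<subseteq> {w \<otimes> x | x. x \<in> carrier G}"
      using c by (blast intro: m_closed)+
  qed
  show "b \<in> H_class G u"
    using one_sided[OF u y] one_sided[OF y u] y
    unfolding H_class_def green_L_def green_R_def group_inverse_def by blast
qed

lemma group_H_class:
  assumes "group_inverse u e z"
  shows "group (G\<lparr>carrier := H_class G u, one := e\<rparr>)"
  unfolding H_class_eq_unit_group[OF assms]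
proof (rule groupI; simp)
  show "\<exists>y. group_inverse (v \<otimes> w) e y"
    if "\<exists>y. group_inverse v e y" "\<exists>y. group_inverse w e y" for v w
    using that group_inverse_mult by blast
  show "\<exists>y. group_inverse e e y"
    using group_inverse_one[OF assms] by blast
  show "v \<otimes> w \<otimes> x = v \<otimes> (w \<otimes> x)"
    if "\<exists>y. group_inverse v e y" "\<exists>y. group_inverse w e y" "\<exists>y. group_inverse x e y" for v w x
    using that m_assoc by (auto simp: group_inverse_def)
  show "e \<otimes> v = v" if "\<exists>y. group_inverse v e y" for v
    using that by (auto simp: group_inverse_def)
  show "\<exists>y. (\<exists>x. group_inverse y e x) \<and> y \<otimes> v = e" if "\<exists>y. group_inverse v e y" for v
    using that group_inverse_sym unfolding group_inverse_def by blast
qed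

text \<open>
  This justifies the definite description of \<open>idem_of\<close>: if two powers \<open>a^t\<close> and \<open>a^s\<close> lie in groups
  with identities \<open>e\<close> and \<open>f\<close>, then \<open>a^(ts)\<close> lies in both of these groups, and an element of two
  groups forces their identities to agree.
\<close>

lemma idem_of_eqI:
  assumes a: "a \<in> carrier G" and "(t::nat) \<ge> 1" and y: "group_inverse (a [^] t) e y"
  shows "idem_of G a = e"
  unfolding idem_of_def
proof (rule the_equality)
  show "\<exists>t::nat. t \<ge> 1 \<and> group (G\<lparr>carrier := H_class G (a [^] t), one := e\<rparr>)"
    using group_H_class[OF y] \<open>t \<ge> 1\<close> by blast
next
  fix f assume "\<exists>s::nat. s \<ge> 1 \<and> group (G\<lparr>carrier := H_class G (a [^] s), one := f\<rparr>)"
  then obtain s :: nat where "s \<ge> 1" and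
    s: "group (G\<lparr>carrier := H_class G (a [^] s), one := f\<rparr>)"
    by blast
  have "a [^] s \<in> H_class G (a [^] s)" "H_class G (a [^] s) \<subseteq> carrier G"
    using a by (auto simp: H_class_def green_L_def green_R_def)
  then obtain z where "group_inverse (a [^] s) f z"
    using group_inverse_of_subgroup[OF _ s] by blast
  then obtain z' where "group_inverse (a [^] (t * s)) f z'"
    using group_inverse_pow_mult[of a s f z t] a \<open>t \<ge> 1\<close> by (auto simp: mult.commute)
  moreover obtain y' where "group_inverse (a [^] (t * s)) e y'"
    using group_inverse_pow_mult[OF y a \<open>s \<ge> 1\<close>] by blast
  ultimately show "f = e"
    by (rule group_identity_unique)
qed

text \<open>
  The point is that \<open>e\<close> is a multiple of \<open>a^t\<close> on either side and \<open>a\<close> commutes with \<open>a^t\<close>, so both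
  \<open>a \<otimes> e\<close> and \<open>e \<otimes> a\<close> reduce to \<open>e \<otimes> a \<otimes> e\<close>.
\<close>

lemma group_identity_commutes:
  assumes a: "a \<in> carrier G" and y: "group_inverse (a [^] (t::nat)) e y"
  shows "a \<otimes> e = e \<otimes> a"
proof -
  let ?u = "a [^] t"
  have c: "?u \<in> carrier G" "e \<in> carrier G" "y \<in> carrier G"
    and eq: "e \<otimes> ?u = ?u" "?u \<otimes> e = ?u" "?u \<otimes> y = e" "y \<otimes> ?u = e"
    using y by (auto simp: group_inverse_def)
  have comm: "a \<otimes> ?u = ?u \<otimes> a"
    using a by (metis nat_pow_Suc nat_pow_Suc2)
  have "a \<otimes> e = e \<otimes> (a \<otimes> e)"
    using a c eq comm by (metis m_assoc m_closed)
  also have "\<dots> = e \<otimes> a"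
    using a c eq comm by (metis m_assoc m_closed)
  finally show ?thesis .
qed

end

lemma (in epigroup_monoid) idem_of_group_inverse:
  assumes a: "a \<in> carrier S"
  shows "\<exists>t\<ge>1. \<exists>y. group_inverse (a [^] (t::nat)) (idem_of S a) y"
proof -
  obtain t :: nat and H where "t \<ge> 1" "semigroup_subgroup H S" "a [^] t \<in> H"
    using all_group_bound[OF a] unfolding group_bound_def by blast
  then obtain e y where "group_inverse (a [^] t) e y"
    unfolding semigroup_subgroup_def using group_inverse_of_subgroup by blast
  then show ?thesis
    using idem_of_eqI[OF a \<open>t \<ge> 1\<close>] \<open>t \<ge> 1\<close> by auto
qed

section \<open>The conjugacy relations in a monoid\<close>

context monoid
begin

lemma p_conj_sym: "(a, b) \<in> p_conj G \<Longrightarrow> (b, a) \<in> p_conj G"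
  by (auto simp: p_conj_def)

lemma sg_conj_sym: "(a, b) \<in> sg_conj G \<Longrightarrow> (b, a) \<in> sg_conj G"
  unfolding sg_conj_def by (metis p_conj_sym sym_def sym_trancl)

lemma unit_cancel:
  assumes "g \<in> Units G" "x \<in> carrier G"
  shows "inv g \<otimes> (g \<otimes> x) = x" "g \<otimes> (inv g \<otimes> x) = x"
  using assms by (simp_all add: m_assoc[symmetric] Units_closed)

lemma G_conj_sym:
  assumes "(a, b) \<in> G_conj G"
  shows "(b, a) \<in> G_conj G"
proof -
  obtain g where c: "a \<in> carrier G" "b \<in> carrier G" and g: "g \<in> Units G"
    and ab: "a = inv g \<otimes> b \<otimes> g"
    using assms by (auto simp: G_conj_def)
  have "b = inv (inv g) \<otimes> a \<otimes> inv g"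
    using c g by (simp add: ab m_assoc Units_closed unit_cancel)
  then show ?thesis
    using c Units_inv_Units[OF g] unfolding G_conj_def by blast
qed

lemma G_conj_trans:
  assumes "(a, b) \<in> G_conj G" "(b, c) \<in> G_conj G"
  shows "(a, c) \<in> G_conj G"
proof -
  obtain g h where c: "a \<in> carrier G" "c \<in> carrier G" and g: "g \<in> Units G" and h: "h \<in> Units G"
    and a: "a = inv g \<otimes> (inv h \<otimes> c \<otimes> h) \<otimes> g"
    using assms by (auto simp: G_conj_def)
  have "inv (h \<otimes> g) = inv g \<otimes> inv h"
    using g h by (intro inv_unique'[symmetric]) (simp_all add: m_assoc Units_closed unit_cancel)
  then have "a = inv (h \<otimes> g) \<otimes> c \<otimes> (h \<otimes> g)"
    using a c g h by (simp add: m_assoc Units_closed)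
  then show ?thesis
    using c g h by (auto simp: G_conj_def)
qed

lemma G_conj_imp_p_conj:
  assumes "(a, b) \<in> G_conj G"
  shows "(a, b) \<in> p_conj G"
proof -
  obtain g where c: "a \<in> carrier G" "b \<in> carrier G" and g: "g \<in> Units G"
    and ab: "a = (inv g \<otimes> b) \<otimes> g"
    using assms by (auto simp: G_conj_def)
  have "b = g \<otimes> (inv g \<otimes> b)"
    using c g by (simp add: unit_cancel)
  then show ?thesis
    using ab c g Units_closed Units_inv_closed unfolding p_conj_def by blast
qed

lemma mult_pow_shift:
  assumes "x \<in> carrier G" "y \<in> carrier G"
  shows "(x \<otimes> y) [^] (n::nat) \<otimes> x = x \<otimes> (y \<otimes> x) [^] n"
proof (induction n)
  case 0
  then show ?case using assms by simp
next
  case (Suc n)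
  have "(x \<otimes> y) [^] Suc n \<otimes> x = ((x \<otimes> y) [^] n \<otimes> x) \<otimes> (y \<otimes> x)"
    using assms by (simp add: m_assoc)
  then show ?case
    using Suc.IH assms by (simp add: m_assoc)
qed

end

section \<open>Idempotents of an inverse monoid\<close>

context inverse_monoid
begin

lemma sinv:
  assumes "s \<in> carrier S"
  shows sinv_closed [simp]: "sinv S s \<in> carrier S"
    and mult_sinv_mult: "s \<otimes> sinv S s \<otimes> s = s"
    and sinv_mult_sinv: "sinv S s \<otimes> s \<otimes> sinv S s = sinv S s"
  using theI'[OF unique_inverse[OF assms]] unfolding sinv_def by blast+

lemma inverse_unique:
  assumes "s \<in> carrier S" "t \<in> carrier S" "t' \<in> carrier S"
    and "s \<otimes> t \<otimes> s = s" "t \<otimes> s \<otimes> t = t" "s \<otimes> t' \<otimes> s = s" "t' \<otimes> s \<otimes> t' = t'"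
  shows "t = t'"
  using unique_inverse[OF assms(1)] assms by blast

lemma mult_sinv_idem:
  assumes "s \<in> carrier S"
  shows "(s \<otimes> sinv S s) \<otimes> (s \<otimes> sinv S s) = s \<otimes> sinv S s"
    "(sinv S s \<otimes> s) \<otimes> (sinv S s \<otimes> s) = sinv S s \<otimes> s"
  using assms sinv[OF assms] by (metis m_assoc m_closed)+

text \<open>
  The inverse \<open>x\<close> of \<open>e \<otimes> f\<close> must equal \<open>f \<otimes> x \<otimes> e\<close>, because that is an inverse of \<open>e \<otimes> f\<close> too.
  This makes \<open>x\<close> idempotent and therefore its own inverse, so that \<open>x\<close> is \<open>e \<otimes> f\<close>.
\<close>

lemma idem_mult_idem:
  assumes c: "e \<in> carrier S" "f \<in> carrier S" and ee: "e \<otimes> e = e" and ff: "f \<otimes> f = f"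
  shows "(e \<otimes> f) \<otimes> (e \<otimes> f) = e \<otimes> f"
proof -
  define x where "x = sinv S (e \<otimes> f)"
  have x: "x \<in> carrier S" "e \<otimes> f \<otimes> x \<otimes> (e \<otimes> f) = e \<otimes> f" "x \<otimes> (e \<otimes> f) \<otimes> x = x"
    using sinv[of "e \<otimes> f"] c by (auto simp: x_def)
  have "e \<otimes> f \<otimes> (f \<otimes> x \<otimes> e) \<otimes> (e \<otimes> f) = e \<otimes> (f \<otimes> f) \<otimes> x \<otimes> ((e \<otimes> e) \<otimes> f)"
    using c x(1) by (simp add: m_assoc)
  also have "\<dots> = e \<otimes> f"
    using x ee ff by simp
  finally have 1: "e \<otimes> f \<otimes> (f \<otimes> x \<otimes> e) \<otimes> (e \<otimes> f) = e \<otimes> f" .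
  have sq: "f \<otimes> x \<otimes> e \<otimes> (f \<otimes> x \<otimes> e) = f \<otimes> x \<otimes> e"
  proof -
    have "f \<otimes> x \<otimes> e \<otimes> (f \<otimes> x \<otimes> e) = f \<otimes> (x \<otimes> (e \<otimes> f) \<otimes> x) \<otimes> e"
      using c x(1) by (simp add: m_assoc)
    then show ?thesis
      using x by simp
  qed
  have "f \<otimes> x \<otimes> e \<otimes> (e \<otimes> f) \<otimes> (f \<otimes> x \<otimes> e) = f \<otimes> x \<otimes> (e \<otimes> e) \<otimes> ((f \<otimes> f) \<otimes> x \<otimes> e)"
    using c x(1) by (simp add: m_assoc)
  also have "\<dots> = f \<otimes> x \<otimes> e"
    using ee ff sq by simp
  finally have 2: "f \<otimes> x \<otimes> e \<otimes> (e \<otimes> f) \<otimes> (f \<otimes> x \<otimes> e) = f \<otimes> x \<otimes> e" .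
  have "x = f \<otimes> x \<otimes> e"
    using inverse_unique[of "e \<otimes> f" x "f \<otimes> x \<otimes> e"] 1 2 x c by simp
  then have xx: "x \<otimes> x = x"
    using sq by simp
  have "x = e \<otimes> f"
    using inverse_unique[of x x "e \<otimes> f"] x c xx by simp
  then show ?thesis
    using xx by simp
qed

text \<open>
  Both \<open>e \<otimes> f\<close> and \<open>f \<otimes> e\<close> are inverse to the idempotent \<open>e \<otimes> f\<close>.
\<close>

lemma idem_commute:
  assumes c: "e \<in> carrier S" "f \<in> carrier S" and ee: "e \<otimes> e = e" and ff: "f \<otimes> f = f"
  shows "e \<otimes> f = f \<otimes> e"
proof -
  have 1: "(e \<otimes> f) \<otimes> (e \<otimes> f) = e \<otimes> f" and 2: "(f \<otimes> e) \<otimes> (f \<otimes> e) = f \<otimes> e"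
    using assms by (simp_all add: idem_mult_idem)
  have "e \<otimes> f \<otimes> (f \<otimes> e) \<otimes> (e \<otimes> f) = e \<otimes> (f \<otimes> f) \<otimes> (e \<otimes> e) \<otimes> f"
    using c by (simp add: m_assoc)
  also have "\<dots> = e \<otimes> f"
    using 1 c ee ff by (simp add: m_assoc)
  finally have 3: "e \<otimes> f \<otimes> (f \<otimes> e) \<otimes> (e \<otimes> f) = e \<otimes> f" .
  have "f \<otimes> e \<otimes> (e \<otimes> f) \<otimes> (f \<otimes> e) = f \<otimes> (e \<otimes> e) \<otimes> (f \<otimes> f) \<otimes> e"
    using c by (simp add: m_assoc)
  also have "\<dots> = f \<otimes> e"
    using 2 c ee ff by (simp add: m_assoc)
  finally have 4: "f \<otimes> e \<otimes> (e \<otimes> f) \<otimes> (f \<otimes> e) = f \<otimes> e" .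
  show ?thesis
    using inverse_unique[of "e \<otimes> f" "e \<otimes> f" "f \<otimes> e"] 1 3 4 c by simp
qed

text \<open>
  In an inverse monoid a principal one-sided ideal is generated by at most one idempotent: two such
  idempotents absorb each other on one side, and they commute.  The next two lemmas are the tool
  for identifying idempotents that arise in different ways from one element \<open>u\<close>.
\<close>

lemma idem_eq_of_left_ideal:
  assumes c: "u \<in> carrier S" "e \<in> carrier S" "f \<in> carrier S" "p \<in> carrier S" "q \<in> carrier S"
    and "e \<otimes> e = e" "f \<otimes> f = f"
    and e: "u \<otimes> e = u" "p \<otimes> u = e" and f: "u \<otimes> f = u" "q \<otimes> u = f"
  shows "e = f"
proof -
  have "e = e \<otimes> f" "f = f \<otimes> e"
    using c e f by (metis m_assoc)+
  then show ?thesis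
    using idem_commute assms by metis
qed

lemma idem_eq_of_right_ideal:
  assumes c: "u \<in> carrier S" "e \<in> carrier S" "f \<in> carrier S" "p \<in> carrier S" "q \<in> carrier S"
    and "e \<otimes> e = e" "f \<otimes> f = f"
    and e: "e \<otimes> u = u" "u \<otimes> p = e" and f: "f \<otimes> u = u" "u \<otimes> q = f"
  shows "e = f"
proof -
  have "e = f \<otimes> e" "f = e \<otimes> f"
    using c e f by (metis m_assoc)+
  then show ?thesis
    using idem_commute assms by metis
qed

lemma sinv_unit:
  assumes "g \<in> Units S"
  shows "sinv S g = inv g"
proof -
  have "g \<in> carrier S"
    using assms by (rule Units_closed)
  show ?thesis
    by (rule inverse_unique[OF \<open>g \<in> carrier S\<close>]) (use assms sinv[of g] in auto)
qed

section \<open>Every group-bound element is conjugate to its group part\<close>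

text \<open>
  For partial injective maps composed from left to right, \<open>F n\<close> is the identity on the range of
  \<open>a^n\<close>, so \<open>F n \<otimes> a\<close> is \<open>a\<close> restricted to smaller and smaller sets.  The swap behind each step has the
  factors \<open>F n \<otimes> a\<close> and \<open>F (n + 1)\<close>.  Everything follows by induction from
  \<open>F (n + 1) = sinv a \<otimes> F n \<otimes> a\<close>, since \<open>F n\<close> commutes with the idempotent \<open>a \<otimes> sinv a\<close>.
\<close>

lemma p_conj_chain:
  assumes a: "a \<in> carrier S"
  defines "F \<equiv> \<lambda>n::nat. sinv S a [^] n \<otimes> a [^] n"
  shows "F n \<in> carrier S" "F n \<otimes> F n = F n" "a [^] n \<otimes> F n = a [^] n"
    "(F n \<otimes> a, F (Suc n) \<otimes> a) \<in> p_conj S"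
proof -
  let ?p = "sinv S a"
  let ?r = "a \<otimes> ?p"
  have p: "?p \<in> carrier S"
    using a by simp
  have F: "F n \<in> carrier S" for n
    using a by (simp add: F_def)
  have F_Suc: "F (Suc n) = ?p \<otimes> F n \<otimes> a" for n
    unfolding F_def nat_pow_Suc2[OF p] using a by (simp add: m_assoc)
  have ra: "?r \<otimes> a = a"
    using a mult_sinv_mult by simp
  have rr: "?r \<otimes> ?r = ?r" and r: "?r \<in> carrier S"
    using a mult_sinv_idem by auto
  have idem: "F n \<otimes> F n = F n" for n
  proof (induction n)
    case 0
    then show ?case by (simp add: F_def)
  next
    case (Suc n)
    have "F (Suc n) \<otimes> F (Suc n) = ?p \<otimes> (F n \<otimes> ?r) \<otimes> F n \<otimes> a"
      using a p F by (simp add: F_Suc m_assoc)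
    also have "\<dots> = ?p \<otimes> ?r \<otimes> (F n \<otimes> F n) \<otimes> a"
      using idem_commute[OF F r Suc.IH rr] a p F by (simp add: m_assoc)
    also have "\<dots> = (?p \<otimes> a \<otimes> ?p) \<otimes> F n \<otimes> a"
      using Suc.IH a p F by (simp add: m_assoc)
    finally show ?case
      using a sinv_mult_sinv by (simp add: F_Suc)
  qed
  have comm: "F n \<otimes> ?r = ?r \<otimes> F n" for n
    using idem_commute[OF F r idem rr] .
  have F_dec: "F (Suc n) \<otimes> F n = F (Suc n)" for n
  proof (induction n)
    case 0
    then show ?case using a by (simp add: F_def)
  next
    case (Suc n)
    have "F (Suc (Suc n)) \<otimes> F (Suc n) = ?p \<otimes> F (Suc n) \<otimes> (?r \<otimes> F n) \<otimes> a"
      using a p F by (simp add: F_Suc[of "Suc n"] F_Suc[of n] m_assoc)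
    also have "\<dots> = ?p \<otimes> (F (Suc n) \<otimes> F n) \<otimes> (?r \<otimes> a)"
      using a p F by (simp add: comm[symmetric] m_assoc)
    finally show ?case
      using Suc.IH ra by (simp add: F_Suc[of "Suc n"])
  qed
  have a_F: "a [^] n \<otimes> F n = a [^] n" for n
  proof (induction n)
    case 0
    then show ?case by (simp add: F_def)
  next
    case (Suc n)
    have "a [^] Suc n \<otimes> F (Suc n) = a [^] n \<otimes> (?r \<otimes> F n) \<otimes> a"
      using a p F by (simp add: F_Suc m_assoc)
    also have "\<dots> = (a [^] n \<otimes> F n) \<otimes> (?r \<otimes> a)"
      using a p F by (simp add: comm[symmetric] m_assoc)
    finally show ?case
      using Suc.IH ra by simp
  qed
  have "(F n \<otimes> a) \<otimes> F (Suc n) = F n \<otimes> (?r \<otimes> F n) \<otimes> a"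
    using a p F by (simp add: F_Suc m_assoc)
  also have "\<dots> = (F n \<otimes> F n) \<otimes> (?r \<otimes> a)"
    using a p F by (simp add: comm[symmetric] m_assoc)
  finally have "F n \<otimes> a = (F n \<otimes> a) \<otimes> F (Suc n)"
    using ra idem by simp
  moreover have "F (Suc n) \<otimes> a = F (Suc n) \<otimes> (F n \<otimes> a)"
    using a F F_dec by (simp add: m_assoc[symmetric])
  ultimately show "(F n \<otimes> a, F (Suc n) \<otimes> a) \<in> p_conj S"
    unfolding p_conj_def using a F by (blast intro: m_closed)
  show "F n \<in> carrier S" "F n \<otimes> F n = F n" "a [^] n \<otimes> F n = a [^] n"
    by (fact F idem a_F)+
qed

lemma sg_conj_mult_group_identity:
  assumes a: "a \<in> carrier S" and "t \<ge> 1" and y: "group_inverse (a [^] (t::nat)) e y"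
  shows "(a, a \<otimes> e) \<in> sg_conj S"
proof -
  let ?F = "\<lambda>n::nat. sinv S a [^] n \<otimes> a [^] n"
  have chain: "(?F 0 \<otimes> a, ?F (Suc n) \<otimes> a) \<in> sg_conj S" for n
    unfolding sg_conj_def
    by (induction n) (use p_conj_chain(4)[OF a] in \<open>blast intro: trancl.intros\<close>)+
  have "(a, ?F t \<otimes> a) \<in> sg_conj S"
    using chain[of "t - 1"] a \<open>t \<ge> 1\<close> by simp
  \<comment> \<open>Both idempotents generate the left ideal of \<open>a^t\<close>.\<close>
  moreover have "?F t = e"
  proof (rule idem_eq_of_left_ideal[of "a [^] t" _ _ "sinv S a [^] t" y])
    show "?F t \<in> carrier S" "?F t \<otimes> ?F t = ?F t" "a [^] t \<otimes> ?F t = a [^] t"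
      using p_conj_chain[OF a] by blast+
  qed (use a y group_inverse_idem[OF y] in \<open>auto simp: group_inverse_def\<close>)
  ultimately show ?thesis
    using group_identity_commutes[OF a y] by simp
qed

end

section \<open>A swap of factors becomes conjugation by a unit\<close>

context factorizable_inverse_monoid
begin

text \<open>The natural order compares \<open>u\<close> with a unit \<open>g\<close>; cancelling \<open>g\<close> yields a factorization.\<close>

lemma factorize:
  assumes u: "u \<in> carrier S"
  shows "\<exists>g\<in>Units S. u = u \<otimes> sinv S u \<otimes> g"
proof -
  obtain g where g: "g \<in> Units S" and "u \<otimes> sinv S u = u \<otimes> inv g"
    using factorizable[OF u] sinv_unit unfolding natural_le_def by metis
  then have "u \<otimes> sinv S u \<otimes> g = u"
    using u g by (simp add: m_assoc Units_closed)
  then show ?thesis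
    using g by metis
qed

text \<open>
  The unit comes from factorizing \<open>u = e \<otimes> x = x \<otimes> f\<close>.  This element satisfies \<open>u \<otimes> y = a \<otimes> e\<close> and
  \<open>y \<otimes> u = b \<otimes> f\<close>, so it intertwines the two group parts.  Because these are invertible at \<open>e\<close> and
  \<open>f\<close>, the idempotents \<open>u \<otimes> sinv u\<close> and \<open>sinv u \<otimes> u\<close> are \<open>e\<close> and \<open>f\<close> themselves, whence
  \<open>b \<otimes> f = sinv u \<otimes> (a \<otimes> e) \<otimes> u\<close>.  Writing \<open>u = e \<otimes> g\<close> turns this into conjugation by \<open>g\<close>.
\<close>

lemma p_conj_imp_G_conj:
  assumes x: "x \<in> carrier S" and y: "y \<in> carrier S"
    and "t \<ge> 1" and "group_inverse ((x \<otimes> y) [^] (t::nat)) e z"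
    and "s \<ge> 1" and "group_inverse ((y \<otimes> x) [^] (s::nat)) f w"
  shows "(x \<otimes> y \<otimes> e, y \<otimes> x \<otimes> f) \<in> G_conj S"
proof -
  let ?a = "x \<otimes> y" and ?b = "y \<otimes> x"
  \<comment> \<open>A common exponent, written as a successor so that one factor can be split off below.\<close>
  define n where "n = t * s - 1"
  have n: "Suc n = t * s"
    using \<open>t \<ge> 1\<close> \<open>s \<ge> 1\<close> by (simp add: n_def)
  obtain z' where z': "group_inverse (?a [^] Suc n) e z'"
    using group_inverse_pow_mult[OF assms(4) _ \<open>s \<ge> 1\<close>] x y n by auto
  obtain w' where w': "group_inverse (?b [^] Suc n) f w'"
    using group_inverse_pow_mult[OF assms(6) _ \<open>t \<ge> 1\<close>] x y n by (auto simp: mult.commute)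
  let ?A = "?a [^] Suc n" and ?B = "?b [^] Suc n"
  have ce: "e \<in> carrier S" "z' \<in> carrier S" "?A \<in> carrier S"
    and e: "e \<otimes> ?A = ?A" "?A \<otimes> e = ?A" "?A \<otimes> z' = e" "z' \<otimes> ?A = e"
    using z' unfolding group_inverse_def by blast+
  have cf: "f \<in> carrier S" "w' \<in> carrier S" "?B \<in> carrier S"
    and f: "f \<otimes> ?B = ?B" "?B \<otimes> f = ?B" "?B \<otimes> w' = f" "w' \<otimes> ?B = f"
    using w' unfolding group_inverse_def by blast+
  have ee: "e \<otimes> e = e" and ff: "f \<otimes> f = f"
    using group_inverse_idem z' w' by blast+
  have shift: "?A \<otimes> x = x \<otimes> ?B"
    using mult_pow_shift[OF x y] .
  define u where "u = e \<otimes> x"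
  have u: "u \<in> carrier S"
    using ce x by (simp add: u_def)
  have ae: "?a \<otimes> e = e \<otimes> ?a" and bf: "?b \<otimes> f = f \<otimes> ?b"
    using group_identity_commutes[OF _ z'] group_identity_commutes[OF _ w'] x y by simp_all
  have "u = e \<otimes> x \<otimes> f"
    unfolding u_def using ce cf e f x shift by (metis m_assoc m_closed)
  moreover have "x \<otimes> f = e \<otimes> x \<otimes> f"
    using ce cf e f x shift by (metis m_assoc m_closed)
  ultimately have u_f: "u = x \<otimes> f"
    by simp
  have eu: "e \<otimes> u = u"
    using ce ee x by (simp add: u_def m_assoc[symmetric])
  have uf: "u \<otimes> f = u"
    using cf ff x by (simp add: u_f m_assoc)
  let ?i = "sinv S u"
  have i: "?i \<in> carrier S"
    using u by simp
  have uy: "u \<otimes> y = ?a \<otimes> e"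
    using ae ce x y by (simp add: u_def m_assoc)
  have yu: "y \<otimes> u = ?b \<otimes> f"
    using cf x y by (simp add: u_f m_assoc)
  \<comment> \<open>\<open>u\<close> is a left factor of \<open>e \<otimes> a^(n+1)\<close>, and so of \<open>e\<close>.\<close>
  have ui: "u \<otimes> ?i = e"
  proof (rule idem_eq_of_right_ideal[of u _ _ ?i "y \<otimes> ?a [^] n \<otimes> z'"])
    have "u \<otimes> (y \<otimes> ?a [^] n \<otimes> z') = e \<otimes> (?a \<otimes> ?a [^] n) \<otimes> z'"
      using ce x y by (simp add: u_def m_assoc)
    also have "\<dots> = e \<otimes> ?A \<otimes> z'"
      using nat_pow_Suc2[of ?a n] x y by (metis m_closed)
    finally show "u \<otimes> (y \<otimes> ?a [^] n \<otimes> z') = e"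
      using e by simp
  qed (use u i x y ce ee eu mult_sinv_mult[OF u] mult_sinv_idem[OF u] in auto)
  \<comment> \<open>Dually, \<open>u\<close> is a right factor of \<open>f\<close>.\<close>
  have iu: "?i \<otimes> u = f"
  proof (rule idem_eq_of_left_ideal[of u _ _ ?i "w' \<otimes> ?b [^] n \<otimes> y"])
    have "w' \<otimes> ?b [^] n \<otimes> y \<otimes> u = w' \<otimes> (?b [^] n \<otimes> ?b) \<otimes> f"
      using cf x y by (simp add: u_f m_assoc)
    also have "\<dots> = w' \<otimes> ?B \<otimes> f"
      by simp
    finally show "w' \<otimes> ?b [^] n \<otimes> y \<otimes> u = f"
      using f ff by simp
  qed (use u i x y cf ff uf mult_sinv_mult[OF u] mult_sinv_idem[OF u] in \<open>auto simp: m_assoc\<close>)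
  obtain g where g: "g \<in> Units S" and ug: "u = e \<otimes> g"
    using factorize[OF u] ui by auto
  have gc: "g \<in> carrier S"
    using g by (rule Units_closed)
  have uinv: "u \<otimes> inv g = e"
    using g gc ce by (simp add: ug m_assoc)
  have ae_u: "?a \<otimes> e \<otimes> u = u \<otimes> (?b \<otimes> f)"
    using u y by (simp add: uy[symmetric] yu[symmetric] m_assoc)
  have i_g: "?i = inv g \<otimes> e"
  proof (rule inverse_unique[OF u])
    show "u \<otimes> (inv g \<otimes> e) \<otimes> u = u"
      using g gc u ce ee eu uinv by (simp add: m_assoc[symmetric])
    have "inv g \<otimes> e \<otimes> u \<otimes> (inv g \<otimes> e) = inv g \<otimes> (e \<otimes> (u \<otimes> inv g) \<otimes> e)"
      using g gc u ce by (simp add: m_assoc)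
    then show "inv g \<otimes> e \<otimes> u \<otimes> (inv g \<otimes> e) = inv g \<otimes> e"
      using uinv ee by simp
  qed (use g gc u i ce mult_sinv_mult[OF u] sinv_mult_sinv[OF u] in auto)
  have "?b \<otimes> f = ?i \<otimes> u \<otimes> (?b \<otimes> f)"
    using bf cf ff x y iu by (simp add: m_assoc[symmetric])
  also have "\<dots> = ?i \<otimes> (?a \<otimes> e \<otimes> u)"
    using i u x y cf ae_u by (simp add: m_assoc)
  also have "\<dots> = inv g \<otimes> (e \<otimes> ?a) \<otimes> (e \<otimes> e) \<otimes> g"
    unfolding i_g using g gc ce x y by (simp add: ug m_assoc)
  also have "\<dots> = inv g \<otimes> (?a \<otimes> e) \<otimes> g"
    using g gc ce ee x y by (simp add: ae[symmetric] m_assoc)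
  finally have "(?b \<otimes> f, ?a \<otimes> e) \<in> G_conj S"
    using g gc x y ce cf unfolding G_conj_def by blast
  then show ?thesis
    by (rule G_conj_sym)
qed

end

theorem theorem3:
  fixes S (structure) and a b
  assumes "factorizable_inverse_monoid S"
    and "epigroup_monoid S"
    and "a \<in> carrier S" and "b \<in> carrier S"
  shows "(a, b) \<in> sg_conj S \<longleftrightarrow>
    (a \<otimes> idem_of S a, b \<otimes> idem_of S b) \<in> G_conj S"
proof -
  interpret factorizable_inverse_monoid S
    by fact
  interpret epigroup_monoid S
    by fact
  let ?tr = "\<lambda>c. c \<otimes> idem_of S c"
  have to_tr: "(c, ?tr c) \<in> sg_conj S" if "c \<in> carrier S" for c
    using idem_of_group_inverse[OF that] sg_conj_mult_group_identity[OF that] by blast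
  have p_step: "(?tr c, ?tr d) \<in> G_conj S" if cd: "(c, d) \<in> p_conj S" for c d
  proof -
    obtain x y where xy: "x \<in> carrier S" "y \<in> carrier S" and eq: "c = x \<otimes> y" "d = y \<otimes> x"
      using cd by (auto simp: p_conj_def)
    then show ?thesis
      using p_conj_imp_G_conj[OF xy] idem_of_group_inverse[of c] idem_of_group_inverse[of d]
      by (metis m_closed)
  qed
  show ?thesis
  proof
    assume "(a, b) \<in> sg_conj S"
    then show "(?tr a, ?tr b) \<in> G_conj S"
      unfolding sg_conj_def
      by (induction rule: trancl_induct) (blast intro: p_step G_conj_trans)+
  next
    assume "(?tr a, ?tr b) \<in> G_conj S"
    then have "(?tr a, ?tr b) \<in> sg_conj S"
      unfolding sg_conj_def using G_conj_imp_p_conj by blast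
    then show "(a, b) \<in> sg_conj S"
      using to_tr[OF \<open>a \<in> carrier S\<close>] sg_conj_sym[OF to_tr[OF \<open>b \<in> carrier S\<close>]]
      unfolding sg_conj_def by (meson trancl_trans)
  qed
qed

end
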